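(* Let $G$ be a finite nilpotent group of nilpotency class $2$, let $k\ge1$ and $w\in F_k$. Then for every $g$ in the image $w(G)$ we have $$P_{w,G}(g)\ \ge\ \frac{1}{|G'|\,|G|},$$ where $G'=[G,G]$ is the derived subgroup of $G$.
   Context: $F_k$ is the free group on $x_1,\dots,x_k$; $w\in F_k$ induces a word map $w:G^k\to G$ by evaluation, with image $w(G)$. For $g\in G$, $P_{w,G}(g):=|\{(g_1,\dots,g_k)\in G^k: w(g_1,\dots,g_k)=g\}|/|G|^k$. *)

theory Defs
  imports "HOL-Algebra.Algebra"
begin

definition comm_subgroup :: "('a, 'b) monoid_scheme \<Rightarrow> 'a set \<Rightarrow> 'a set \<Rightarrow> 'a set" where
  "comm_subgroup G A B = generate G
     (\<Union>a\<in>A. \<Union>b\<in>B. {a \<otimes>\<^bsub>G\<^esub> b \<otimes>\<^bsub>G\<^esub> inv\<^bsub>G\<^esub> a \<otimes>\<^bsub>G\<^esub> inv\<^bsub>G\<^esub> b})"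

text \<open>Lower central series: gamma_1 = G, gamma_(i+1) = [gamma_i, G]; index n gives gamma_(n+1).\<close>
fun lower_central :: "('a, 'b) monoid_scheme \<Rightarrow> nat \<Rightarrow> 'a set" where
  "lower_central G 0 = carrier G"
| "lower_central G (Suc n) = comm_subgroup G (lower_central G n) (carrier G)"

definition nilpotency_class :: "('a, 'b) monoid_scheme \<Rightarrow> nat \<Rightarrow> bool" where
  "nilpotency_class G c \<longleftrightarrow> lower_central G c = {\<one>\<^bsub>G\<^esub>} \<and> (\<forall>i<c. lower_central G i \<noteq> {\<one>\<^bsub>G\<^esub>})"

text \<open>Words in the free group F_k: lists of letters (i, True) = x_i, (i, False) = x_i^-1, i < k.\<close>
type_synonym fword = "(nat \<times> bool) list"

definition is_word :: "nat \<Rightarrow> fword \<Rightarrow> bool" where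
  "is_word k w \<longleftrightarrow> (\<forall>l\<in>set w. fst l < k)"

definition word_eval :: "('a, 'b) monoid_scheme \<Rightarrow> fword \<Rightarrow> (nat \<Rightarrow> 'a) \<Rightarrow> 'a" where
  "word_eval G w x = foldr (\<lambda>(i, e) acc. (if e then x i else inv\<^bsub>G\<^esub> (x i)) \<otimes>\<^bsub>G\<^esub> acc) w \<one>\<^bsub>G\<^esub>"

definition tuples :: "('a, 'b) monoid_scheme \<Rightarrow> nat \<Rightarrow> (nat \<Rightarrow> 'a) set" where
  "tuples G k = PiE {..<k} (\<lambda>_. carrier G)"

definition word_image :: "('a, 'b) monoid_scheme \<Rightarrow> nat \<Rightarrow> fword \<Rightarrow> 'a set" where
  "word_image G k w = word_eval G w ` tuples G k"

definition word_prob :: "('a, 'b) monoid_scheme \<Rightarrow> nat \<Rightarrow> fword \<Rightarrow> 'a \<Rightarrow> real" where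
  "word_prob G k w g = real (card {x \<in> tuples G k. word_eval G w x = g}) / real (card (carrier G)) ^ k"

end

theory Submission
  imports Defs
begin

text \<open>
  Nielsen substitutions \<open>x\<^sub>i \<mapsto> x\<^sub>i x\<^sub>j\<^sup>\<plusminus>\<^sup>1\<close> permute the tuples over \<open>G\<close>, so they change a word
  without changing the sizes of its fibres. By the Euclidean algorithm they bring \<open>w\<close>, modulo
  triple commutators, into the form \<open>x\<^sub>0\<^sup>n [x\<^sub>0,x\<^sub>1]\<^sup>a [x\<^sub>1,x\<^sub>2]\<^sup>b [x\<^sub>2,x\<^sub>3]\<^sup>c \<dots>\<close>. For such a word, multiplying
  the odd-indexed variables of a tuple (or the even-indexed ones with positive index) by a tuple
  \<open>y\<close> multiplies the value by a homomorphism of \<open>y\<close> into \<open>G'\<close>. Starting from one solution, the kernel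
  of the homomorphism for the even positions has index at most \<open>|G'|\<close>. For each element of it the
  odd positions and a factor \<open>z \<in> G'\<close> of \<open>x\<^sub>0\<close>, which multiplies the value by \<open>z\<^sup>n\<close>, together give a
  homomorphism to \<open>G'\<close>; the freedom in \<open>z\<close> compensates the index of its kernel. Altogether there
  are at least \<open>|G|\<^sup>k\<^sup>-\<^sup>1 / |G'|\<close> solutions.
\<close>

section \<open>Euclidean algorithm on integer vectors\<close>

text \<open>While two coordinates are nonzero, adding plus or minus the smaller one to the larger
  decreases the sum of absolute values. The abstract state \<open>s\<close> with invariant
  \<open>P\<close> lets the argument serve both exponent sums and rows of pair sums.\<close>

lemma euclid_concentrate:
  fixes v :: "'s \<Rightarrow> nat \<Rightarrow> int"
  assumes fin: "finite S" and i0: "i0 \<in> S"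
    and step: "\<And>s i j \<epsilon>. \<lbrakk>P s; i \<in> S; j \<in> S; i \<noteq> j; \<epsilon> = 1 \<or> \<epsilon> = -1\<rbrakk>
      \<Longrightarrow> \<exists>s'. P s' \<and> (\<forall>q\<in>S. v s' q = v s q + (if q = j then \<epsilon> * v s i else 0))"
    and "P s"
  shows "\<exists>s'. P s' \<and> (\<forall>q\<in>S - {i0}. v s' q = 0)"
  using \<open>P s\<close>
proof (induction "nat (\<Sum>q\<in>S. \<bar>v s q\<bar>)" arbitrary: s rule: less_induct)
  case less
  show ?case
  proof (cases "\<exists>i\<in>S. \<exists>j\<in>S. i \<noteq> j \<and> v s i \<noteq> 0 \<and> v s j \<noteq> 0")
    case True
    then obtain i j where ij: "i \<in> S" "j \<in> S" "i \<noteq> j" "v s i \<noteq> 0" "v s j \<noteq> 0" "\<bar>v s i\<bar> \<le> \<bar>v s j\<bar>"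
      by (metis linorder_le_cases)
    \<comment> \<open>The sign is chosen so that the new entry at \<open>j\<close> has absolute
      value \<open>\<bar>v s j\<bar> - \<bar>v s i\<bar>\<close>.\<close>
    define \<epsilon> :: int where "\<epsilon> = (if (v s i > 0) = (v s j > 0) then -1 else 1)"
    have "\<epsilon> = 1 \<or> \<epsilon> = -1" by (auto simp: \<epsilon>_def)
    from step[OF less.prems ij(1-3) this]
    obtain s' where s': "P s'" "\<And>q. q \<in> S \<Longrightarrow> v s' q = v s q + (if q = j then \<epsilon> * v s i else 0)"
      by blast
    have j: "\<bar>v s' j\<bar> < \<bar>v s j\<bar>"
      using s'(2)[OF ij(2)] ij(4-6) by (auto simp: \<epsilon>_def split: if_splits)
    have "(\<Sum>q\<in>S. \<bar>v s' q\<bar>) < (\<Sum>q\<in>S. \<bar>v s q\<bar>)"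
    proof (rule sum_strict_mono_ex1[OF fin])
      show "\<forall>q\<in>S. \<bar>v s' q\<bar> \<le> \<bar>v s q\<bar>"
      proof
        fix q assume "q \<in> S"
        then show "\<bar>v s' q\<bar> \<le> \<bar>v s q\<bar>" using j s'(2)[of q] by (cases "q = j") auto
      qed
    qed (use j ij in blast)
    moreover have "(\<Sum>q\<in>S. \<bar>v s' q\<bar>) \<ge> 0" by (simp add: sum_nonneg)
    ultimately show ?thesis by (intro less.hyps[OF _ s'(1)]) linarith
  next
    case False
    show ?thesis
    proof (cases "\<exists>i\<in>S - {i0}. v s i \<noteq> 0")
      case True
      then obtain i where i: "i \<in> S" "i \<noteq> i0" "v s i \<noteq> 0" by blast
      have z: "v s q = 0" if "q \<in> S" "q \<noteq> i" for q using False i that by blast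
      \<comment> \<open>The only nonzero entry sits at \<open>i\<close>, away from
        \<open>i0\<close>: it is copied to \<open>i0\<close>, and the copy is then subtracted at
        \<open>i\<close>.\<close>
      obtain s' where s': "P s'" "\<And>q. q \<in> S \<Longrightarrow> v s' q = v s q + (if q = i0 then 1 * v s i else 0)"
        using step[OF less.prems i(1) i0 i(2), of 1] by blast
      obtain s'' where s'': "P s''" "\<And>q. q \<in> S \<Longrightarrow> v s'' q = v s' q + (if q = i then - 1 * v s' i0 else 0)"
        using step[OF s'(1) i0 i(1), of "- 1"] i(2) by metis
      have "v s'' q = 0" if "q \<in> S - {i0}" for q
        using that s''(2)[of q] s'(2)[of q] s'(2)[OF i0] z[of q] z[OF i0] i by (cases "q = i") auto
      with s'' show ?thesis by blast
    qed (use less.prems in blast)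
  qed
qed

section \<open>Exponent sums, pair sums and Nielsen substitutions\<close>

fun exp_sum :: "fword \<Rightarrow> nat \<Rightarrow> int" where
  "exp_sum [] i = 0"
| "exp_sum ((l, s) # w) i = (if l = i then if s then 1 else -1 else 0) + exp_sum w i"

text \<open>Signed number of pairs of positions with an \<open>x\<^sub>p\<close>-letter to the left of an \<open>x\<^sub>q\<close>-letter.\<close>
fun pair_sum :: "fword \<Rightarrow> nat \<Rightarrow> nat \<Rightarrow> int" where
  "pair_sum [] p q = 0"
| "pair_sum ((l, s) # w) p q = (if l = p then (if s then 1 else -1) * exp_sum w q else 0) + pair_sum w p q"

text \<open>An \<open>x_p\<close>-letter and an \<open>x_q\<close>-letter occur in exactly one of
  the two orders, so both counts together run over all such pairs.\<close>

lemma pair_sum_swap: "p \<noteq> q \<Longrightarrow> pair_sum w p q + pair_sum w q p = exp_sum w p * exp_sum w q"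
  by (induction w p q rule: pair_sum.induct) (auto simp: algebra_simps)

fun nielsen :: "nat \<Rightarrow> nat \<Rightarrow> bool \<Rightarrow> fword \<Rightarrow> fword" where
  "nielsen i j s [] = []"
| "nielsen i j s ((l, e) # w) =
    (if l = i then if e then [(i, True), (j, s)] else [(j, \<not> s), (i, False)] else [(l, e)]) @ nielsen i j s w"

lemma exp_sum_nielsen:
  "i \<noteq> j \<Longrightarrow> exp_sum (nielsen i j s w) q =
    exp_sum w q + (if q = j then (if s then 1 else -1) * exp_sum w i else 0)"
  by (induction i j s w rule: nielsen.induct) auto

text \<open>The \<open>x_p\<close>-letters stay as they are, and each new \<open>x_j\<close>-letter
  stands next to its \<open>x_i\<close>-letter, on the same side of every \<open>x_p\<close>. Row
  \<open>p\<close> thus undergoes the same elementary addition as the exponent vector.\<close>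

lemma pair_sum_nielsen:
  "\<lbrakk>i \<noteq> j; p \<noteq> i; p \<noteq> j\<rbrakk> \<Longrightarrow> pair_sum (nielsen i j s w) p q =
    pair_sum w p q + (if q = j then (if s then 1 else -1) * pair_sum w p i else 0)"
  by (induction i j s w rule: nielsen.induct) (auto simp: exp_sum_nielsen algebra_simps)

lemma is_word_nielsen: "\<lbrakk>i < k; j < k; is_word k w\<rbrakk> \<Longrightarrow> is_word k (nielsen i j s w)"
  by (induction i j s w rule: nielsen.induct) (auto simp: is_word_def)

section \<open>Kernel counting and tuples with prescribed support\<close>

text \<open>Here \<open>h x y\<close> stands for \<open>y\<close> times the inverse of
  \<open>x\<close>: it carries the fibre of \<open>f\<close> through \<open>x\<close> injectively
  into the kernel. There are at most \<open>card D\<close> fibres, none larger than the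
  kernel.\<close>

lemma card_le_card_mult_kernel:
  assumes "finite D" "finite A" "f ` A \<subseteq> D"
    and "\<And>x. x \<in> A \<Longrightarrow> inj_on (h x) A"
    and "\<And>x y. \<lbrakk>x \<in> A; y \<in> A; f y = f x\<rbrakk> \<Longrightarrow> h x y \<in> A \<and> f (h x y) = e"
  shows "card A \<le> card D * card {x \<in> A. f x = e}"
proof -
  have fib: "card {y \<in> A. f y = d} \<le> card {x \<in> A. f x = e}" for d
  proof (cases "\<exists>x\<in>A. f x = d")
    case True
    then obtain x where x: "x \<in> A" "f x = d" by blast
    show ?thesis
    proof (rule card_inj_on_le[where f = "h x"])
      show "inj_on (h x) {y \<in> A. f y = d}"
        using assms(4)[OF x(1)] by (rule inj_on_subset) blast
    qed (use assms x in auto)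
  next
    case False
    then have "{y \<in> A. f y = d} = {}" by blast
    then show ?thesis by (metis card.empty le0)
  qed
  have "A = (\<Union>d\<in>D. {y \<in> A. f y = d})" using assms(3) by blast
  then have "card A \<le> (\<Sum>d\<in>D. card {y \<in> A. f y = d})"
    by (metis card_UN_le assms(1))
  also have "\<dots> \<le> card D * card {x \<in> A. f x = e}"
    using sum_bounded_above[of D "\<lambda>d. card {y \<in> A. f y = d}", OF fib] by simp
  finally show ?thesis .
qed

text \<open>Tuples are padded by the unit instead of \<open>undefined\<close>, so that tuples with
  different supports can be multiplied pointwise.\<close>

definition supp_tuples :: "('a, 'b) monoid_scheme \<Rightarrow> nat set \<Rightarrow> (nat \<Rightarrow> 'a) set" where
  "supp_tuples G S = {x. (\<forall>i. x i \<in> carrier G) \<and> (\<forall>i. i \<notin> S \<longrightarrow> x i = \<one>\<^bsub>G\<^esub>)}"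

lemma word_eval_Nil [simp]: "word_eval G [] x = \<one>\<^bsub>G\<^esub>"
  by (simp add: word_eval_def)

lemma word_eval_Cons [simp]:
  "word_eval G ((i, e) # w) x = (if e then x i else inv\<^bsub>G\<^esub> (x i)) \<otimes>\<^bsub>G\<^esub> word_eval G w x"
  by (simp add: word_eval_def)

lemma word_eval_cong:
  "\<lbrakk>is_word k w; \<And>i. i < k \<Longrightarrow> x i = y i\<rbrakk> \<Longrightarrow> word_eval G w x = word_eval G w y"
  by (induction w) (auto simp: is_word_def word_eval_def)

text \<open>The normal form with the first \<open>t\<close> rows of the pair-sum matrix cleared
  beyond the superdiagonal. Entries below the diagonal are governed by \<open>pair_sum_swap\<close>,
  since one of two distinct indices is positive and has exponent sum 0.\<close>

definition tridiagonal_below :: "nat \<Rightarrow> nat \<Rightarrow> fword \<Rightarrow> bool" where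
  "tridiagonal_below t k w \<longleftrightarrow> (\<forall>i. 0 < i \<and> i < k \<longrightarrow> exp_sum w i = 0)
     \<and> (\<forall>p q. p < t \<and> Suc p < q \<and> q < k \<longrightarrow> pair_sum w p q = 0)"

context group
begin

section \<open>Fibres of word maps and reduction to the normal form\<close>

lemma bij_betw_supp_tuples:
  "bij_betw (\<lambda>x. restrict x S) (supp_tuples G S) (PiE S (\<lambda>_. carrier G))"
  by (rule bij_betw_byWitness[where f' = "\<lambda>x i. if i \<in> S then x i else \<one>"])
    (auto simp: supp_tuples_def PiE_def extensional_def fun_eq_iff)

lemma card_supp_tuples: "finite S \<Longrightarrow> card (supp_tuples G S) = card (carrier G) ^ card S"
  using bij_betw_same_card[OF bij_betw_supp_tuples] by (simp add: card_PiE)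

lemma finite_supp_tuples: "\<lbrakk>finite S; finite (carrier G)\<rbrakk> \<Longrightarrow> finite (supp_tuples G S)"
  using bij_betw_finite[OF bij_betw_supp_tuples] by (simp add: finite_PiE)

lemma word_eval_closed [simp]: "(\<And>i. x i \<in> carrier G) \<Longrightarrow> word_eval G w x \<in> carrier G"
  by (induction w) (auto simp: word_eval_def)

lemma word_eval_nielsen:
  assumes "\<And>i. x i \<in> carrier G" "i \<noteq> j"
  shows "word_eval G (nielsen i j s w) x = word_eval G w (x(i := x i \<otimes> (if s then x j else inv (x j))))"
  using assms(2) by (induction i j s w rule: nielsen.induct) (auto simp: assms(1) m_assoc inv_mult_group)

definition fibre :: "nat \<Rightarrow> fword \<Rightarrow> 'a \<Rightarrow> (nat \<Rightarrow> 'a) set" where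
  "fibre k w g = {x \<in> supp_tuples G {..<k}. word_eval G w x = g}"

lemma card_fibre:
  assumes "is_word k w"
  shows "card {x \<in> tuples G k. word_eval G w x = g} = card (fibre k w g)"
proof -
  have e: "word_eval G w (restrict x {..<k}) = word_eval G w x" for x
    using assms by (rule word_eval_cong) simp
  have "bij_betw (\<lambda>x. restrict x {..<k}) (fibre k w g) {x \<in> tuples G k. word_eval G w x = g}"
    unfolding fibre_def tuples_def
    by (rule bij_betw_Collect[OF bij_betw_supp_tuples]) (simp add: e)
  then show ?thesis by (simp add: bij_betw_same_card)
qed

text \<open>The change of variables leaves \<open>x j\<close> alone, so the one with the opposite
  sign undoes it.\<close>

lemma card_fibre_nielsen:
  assumes "i < k" "j < k" "i \<noteq> j"
  shows "card (fibre k (nielsen i j s w) g) = card (fibre k w g)"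
proof -
  let ?t = "\<lambda>s x. x(i := x i \<otimes> (if s then x j else inv (x j)))"
  have "bij_betw (?t s) (supp_tuples G {..<k}) (supp_tuples G {..<k})"
    by (rule bij_betw_byWitness[where f' = "?t (\<not> s)"])
      (use assms in \<open>auto simp: supp_tuples_def m_assoc fun_eq_iff\<close>)
  then have "bij_betw (?t s) (fibre k (nielsen i j s w) g) (fibre k w g)"
    unfolding fibre_def
    by (rule bij_betw_Collect) (use assms in \<open>auto simp: supp_tuples_def word_eval_nielsen\<close>)
  then show ?thesis by (rule bij_betw_same_card)
qed

text \<open>The exponent vector is concentrated at index 0 first; then row \<open>t\<close> is
  concentrated at \<open>Suc t\<close> by substitutions among the variables of index above
  \<open>t\<close>.\<close>

lemma ex_tridiagonal_below:
  assumes "is_word k w" "k \<ge> 1"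
  shows "\<exists>w'. is_word k w' \<and> (\<forall>g. card (fibre k w' g) = card (fibre k w g)) \<and> tridiagonal_below t k w'"
proof (induction t)
  case 0
  let ?P = "\<lambda>w'. is_word k w' \<and> (\<forall>g. card (fibre k w' g) = card (fibre k w g))"
  have "\<exists>w'. ?P w' \<and> (\<forall>q\<in>{..<k} - {0}. exp_sum w' q = 0)"
  proof (rule euclid_concentrate[where P = ?P])
    fix s i j and \<epsilon> :: int
    assume *: "?P s" "i \<in> {..<k}" "j \<in> {..<k}" "i \<noteq> j" "\<epsilon> = 1 \<or> \<epsilon> = - 1"
    show "\<exists>s'. ?P s' \<and> (\<forall>q\<in>{..<k}. exp_sum s' q = exp_sum s q + (if q = j then \<epsilon> * exp_sum s i else 0))"
      by (rule exI[where x = "nielsen i j (\<epsilon> = 1) s"])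
        (use * in \<open>auto simp: is_word_nielsen card_fibre_nielsen exp_sum_nielsen\<close>)
  qed (use assms in auto)
  then show ?case by (auto simp: tridiagonal_below_def)
next
  case (Suc t)
  let ?P = "\<lambda>w'. is_word k w' \<and> (\<forall>g. card (fibre k w' g) = card (fibre k w g)) \<and> tridiagonal_below t k w'"
  show ?case
  proof (cases "Suc t < k")
    case True
    obtain w0 where "?P w0" using Suc by blast
    have "\<exists>w'. ?P w' \<and> (\<forall>q\<in>{Suc t..<k} - {Suc t}. pair_sum w' t q = 0)"
    proof (rule euclid_concentrate[where P = ?P])
      fix s i j and \<epsilon> :: int
      assume *: "?P s" "i \<in> {Suc t..<k}" "j \<in> {Suc t..<k}" "i \<noteq> j" "\<epsilon> = 1 \<or> \<epsilon> = - 1"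
      \<comment> \<open>The indices \<open>i\<close> and \<open>j\<close> lie beyond the
        superdiagonal of every row \<open>p < t\<close>, so these rows only have zeros added to
        zeros; the same holds for exponent sums at positive indices.\<close>
      have "tridiagonal_below t k (nielsen i j (\<epsilon> = 1) s)"
        using * by (auto simp: tridiagonal_below_def exp_sum_nielsen pair_sum_nielsen)
      then show "\<exists>s'. ?P s' \<and> (\<forall>q\<in>{Suc t..<k}. pair_sum s' t q = pair_sum s t q + (if q = j then \<epsilon> * pair_sum s t i else 0))"
        by (intro exI[where x = "nielsen i j (\<epsilon> = 1) s"])
          (use * in \<open>auto simp: is_word_nielsen card_fibre_nielsen pair_sum_nielsen\<close>)
    qed (use True \<open>?P w0\<close> in auto)
    then obtain w' where w': "?P w'" "\<forall>q\<in>{Suc t..<k} - {Suc t}. pair_sum w' t q = 0" by blast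
    then have "tridiagonal_below (Suc t) k w'"
      by (auto simp: tridiagonal_below_def less_Suc_eq)
    with w' show ?thesis by blast
  next
    case False
    then have "tridiagonal_below (Suc t) k w'" if "tridiagonal_below t k w'" for w'
      using that by (auto simp: tridiagonal_below_def less_Suc_eq)
    with Suc show ?thesis by blast
  qed
qed

end

section \<open>Commutator calculus in groups of class at most 2\<close>

definition commutator :: "('a, 'b) monoid_scheme \<Rightarrow> 'a \<Rightarrow> 'a \<Rightarrow> 'a" where
  "commutator G a b = a \<otimes>\<^bsub>G\<^esub> b \<otimes>\<^bsub>G\<^esub> inv\<^bsub>G\<^esub> a \<otimes>\<^bsub>G\<^esub> inv\<^bsub>G\<^esub> b"

text \<open>
  The correction in \<open>w(xy) = w(x) w(y) K\<^sub>w(x,y)\<close> for groups of class 2, obtained by moving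
  every \<open>y\<close>-letter to the right past the \<open>x\<close>-letters.
\<close>
fun cross_term :: "('a, 'b) monoid_scheme \<Rightarrow> fword \<Rightarrow> (nat \<Rightarrow> 'a) \<Rightarrow> (nat \<Rightarrow> 'a) \<Rightarrow> 'a" where
  "cross_term G [] x y = \<one>\<^bsub>G\<^esub>"
| "cross_term G ((i, e) # w) x y =
    commutator G (if e then y i else inv\<^bsub>G\<^esub> (y i)) (word_eval G w x)
    \<otimes>\<^bsub>G\<^esub> (if e then \<one>\<^bsub>G\<^esub> else commutator G (y i) (x i)) \<otimes>\<^bsub>G\<^esub> cross_term G w x y"

locale class2_group = group G for G (structure) +
  assumes commutator_central:
    "\<lbrakk>a \<in> carrier G; b \<in> carrier G; c \<in> carrier G\<rbrakk> \<Longrightarrow> commutator G a b \<otimes> c = c \<otimes> commutator G a b"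
begin

abbreviation D where "D \<equiv> derived G (carrier G)"

abbreviation pmult :: "(nat \<Rightarrow> 'a) \<Rightarrow> (nat \<Rightarrow> 'a) \<Rightarrow> nat \<Rightarrow> 'a" (infixl "\<odot>" 70) where
  "x \<odot> y \<equiv> \<lambda>i. x i \<otimes> y i"

lemma subgroup_D: "subgroup D G"
  by (simp add: derived_is_subgroup)

lemmas D_closed [simp] = subgroup.mem_carrier[OF subgroup_D]
lemmas D_mult [simp] = subgroup.m_closed[OF subgroup_D]
lemmas D_inv [simp] = subgroup.m_inv_closed[OF subgroup_D]
lemmas D_one [simp] = subgroup.one_closed[OF subgroup_D]

lemma finite_D: "finite (carrier G) \<Longrightarrow> finite D"
  using subgroup.subset[OF subgroup_D] by (rule finite_subset)

lemma commutator_in_D [simp]: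
  "\<lbrakk>a \<in> carrier G; b \<in> carrier G\<rbrakk> \<Longrightarrow> commutator G a b \<in> D"
  unfolding derived_def commutator_def by (auto intro: generate.incl)

text \<open>The centre is a subgroup containing all commutators, hence also the subgroup they
  generate.\<close>

lemma D_central: "\<lbrakk>d \<in> D; c \<in> carrier G\<rbrakk> \<Longrightarrow> d \<otimes> c = c \<otimes> d"
proof -
  let ?Z = "{z \<in> carrier G. \<forall>c\<in>carrier G. z \<otimes> c = c \<otimes> z}"
  have "subgroup ?Z G"
  proof (rule subgroupI)
    fix a assume a: "a \<in> ?Z"
    then have carr: "a \<in> carrier G" "inv a \<in> carrier G" by blast+
    have "inv a \<otimes> c = c \<otimes> inv a" if c: "c \<in> carrier G" for c
    proof -
      have "a \<otimes> (c \<otimes> inv a) = (a \<otimes> c) \<otimes> inv a" using carr c by (simp add: m_assoc)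
      also have "a \<otimes> c = c \<otimes> a" using a c by blast
      also have "c \<otimes> a \<otimes> inv a = c" using carr c by (simp add: m_assoc)
      finally show ?thesis using carr c by (simp add: inv_solve_left')
    qed
    with a show "inv a \<in> ?Z" by blast
  next
    fix a b assume ab: "a \<in> ?Z" "b \<in> ?Z"
    then have carr: "a \<in> carrier G" "b \<in> carrier G" "a \<otimes> b \<in> carrier G" by blast+
    have "a \<otimes> b \<otimes> c = c \<otimes> (a \<otimes> b)" if c: "c \<in> carrier G" for c
    proof -
      have "a \<otimes> b \<otimes> c = a \<otimes> (b \<otimes> c)" using carr c by (simp add: m_assoc)
      also have "b \<otimes> c = c \<otimes> b" using ab c by blast
      also have "a \<otimes> (c \<otimes> b) = (a \<otimes> c) \<otimes> b" using carr c by (simp add: m_assoc)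
      also have "a \<otimes> c = c \<otimes> a" using ab c by blast
      also have "c \<otimes> a \<otimes> b = c \<otimes> (a \<otimes> b)" using carr c by (simp add: m_assoc)
      finally show ?thesis .
    qed
    with ab show "a \<otimes> b \<in> ?Z" by blast
  qed auto
  moreover have "derived_set G (carrier G) \<subseteq> ?Z"
    using commutator_central unfolding commutator_def by auto
  ultimately have "D \<subseteq> ?Z"
    unfolding derived_def by (rule generate_subgroup_incl[rotated])
  then show "\<lbrakk>d \<in> D; c \<in> carrier G\<rbrakk> \<Longrightarrow> d \<otimes> c = c \<otimes> d" by blast
qed

text \<open>Instances with a fixed \<open>b\<close> serve as rewrite rules that move central factors
  to the front of a product.\<close>

lemma D_lcomm: "\<lbrakk>d \<in> D; b \<in> carrier G; c \<in> carrier G\<rbrakk> \<Longrightarrow> b \<otimes> (d \<otimes> c) = d \<otimes> (b \<otimes> c)"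
  by (metis D_central D_closed m_assoc)

lemma D_int_pow [simp]: "d \<in> D \<Longrightarrow> d [^] (n::int) \<in> D"
  using group.int_pow_closed[OF subgroup.subgroup_is_group[OF subgroup_D is_group], of d n]
  by (simp add: int_pow_consistent[OF subgroup_D])

lemma commutator_swap:
  "\<lbrakk>a \<in> carrier G; b \<in> carrier G\<rbrakk> \<Longrightarrow> a \<otimes> b = commutator G a b \<otimes> (b \<otimes> a)"
  by (simp add: commutator_def m_assoc inv_solve_left) (simp add: m_assoc[symmetric])

text \<open>This turns commutator identities into reorderings of a product.\<close>

lemma commutator_unique:
  "\<lbrakk>a \<in> carrier G; b \<in> carrier G; c \<in> carrier G; a \<otimes> b = c \<otimes> (b \<otimes> a)\<rbrakk> \<Longrightarrow> commutator G a b = c"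
  by (metis D_closed commutator_in_D commutator_swap m_closed right_cancel)

text \<open>Moving \<open>b\<close> to the left past \<open>a'\<close> and then past
  \<open>a\<close> releases one commutator each time, and both are central.\<close>

lemma commutator_mult_left:
  assumes [simp]: "a \<in> carrier G" "a' \<in> carrier G" "b \<in> carrier G"
  shows "commutator G (a \<otimes> a') b = commutator G a b \<otimes> commutator G a' b"
proof (rule commutator_unique)
  have "a \<otimes> a' \<otimes> b = a \<otimes> (commutator G a' b \<otimes> (b \<otimes> a'))"
    by (simp add: m_assoc commutator_swap[of a' b])
  also have "\<dots> = commutator G a' b \<otimes> (a \<otimes> b \<otimes> a')"
    by (simp add: m_assoc D_lcomm[of _ a])
  also have "\<dots> = commutator G a' b \<otimes> (commutator G a b \<otimes> (b \<otimes> a) \<otimes> a')"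
    by (simp add: commutator_swap[of a b])
  also have "\<dots> = commutator G a b \<otimes> commutator G a' b \<otimes> (b \<otimes> (a \<otimes> a'))"
    by (simp add: m_assoc D_lcomm[of "commutator G a' b" "commutator G a b"])
  finally show "a \<otimes> a' \<otimes> b = commutator G a b \<otimes> commutator G a' b \<otimes> (b \<otimes> (a \<otimes> a'))" .
qed simp_all

lemma commutator_mult_right:
  assumes [simp]: "a \<in> carrier G" "b \<in> carrier G" "b' \<in> carrier G"
  shows "commutator G a (b \<otimes> b') = commutator G a b \<otimes> commutator G a b'"
proof (rule commutator_unique)
  have "a \<otimes> (b \<otimes> b') = commutator G a b \<otimes> (b \<otimes> (a \<otimes> b'))"
    using commutator_swap[of a b] by (simp add: m_assoc[symmetric])
  also have "\<dots> = commutator G a b \<otimes> (b \<otimes> (commutator G a b' \<otimes> (b' \<otimes> a)))"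
    by (simp add: commutator_swap[of a b'])
  also have "\<dots> = commutator G a b \<otimes> commutator G a b' \<otimes> (b \<otimes> b' \<otimes> a)"
    by (simp add: m_assoc D_lcomm[of _ b])
  finally show "a \<otimes> (b \<otimes> b') = commutator G a b \<otimes> commutator G a b' \<otimes> (b \<otimes> b' \<otimes> a)" .
qed simp_all

lemma commutator_D_left [simp]: "\<lbrakk>d \<in> D; b \<in> carrier G\<rbrakk> \<Longrightarrow> commutator G d b = \<one>"
  by (rule commutator_unique) (simp_all add: D_central)

lemma commutator_D_right [simp]: "\<lbrakk>d \<in> D; b \<in> carrier G\<rbrakk> \<Longrightarrow> commutator G b d = \<one>"
  by (rule commutator_unique) (simp_all add: D_central)

lemma commutator_int_pow_right:
  assumes "a \<in> carrier G" "b \<in> carrier G"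
  shows "commutator G a (b [^] (n::int)) = commutator G a b [^] n"
  by (rule hom_int_pow[where h = "commutator G a"])
    (use assms in \<open>auto intro!: homI simp: commutator_mult_right\<close>)

lemma commutator_inv_left:
  assumes [simp]: "a \<in> carrier G" "b \<in> carrier G"
  shows "commutator G (inv a) b = inv (commutator G a b)"
  by (rule inv_equality[symmetric]) (simp_all add: commutator_mult_left[symmetric])

lemma commutator_inv_right:
  assumes [simp]: "a \<in> carrier G" "b \<in> carrier G"
  shows "commutator G a (inv b) = inv (commutator G a b)"
  by (rule inv_equality[symmetric]) (simp_all add: commutator_mult_right[symmetric])

section \<open>Word maps on products of tuples: the bilinear correction\<close>

lemma cross_term_in_D [simp]:
  "\<lbrakk>\<And>i. x i \<in> carrier G; \<And>i. y i \<in> carrier G\<rbrakk> \<Longrightarrow> cross_term G w x y \<in> D"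
  by (induction w) auto

lemma word_eval_mult:
  assumes [simp]: "\<And>i. x i \<in> carrier G" "\<And>i. y i \<in> carrier G"
  shows "word_eval G w (x \<odot> y) = word_eval G w x \<otimes> word_eval G w y \<otimes> cross_term G w x y"
proof (induction w)
  case (Cons l w)
  obtain i e where l: "l = (i, e)" by fastforce
  let ?X = "word_eval G w x" and ?Y = "word_eval G w y" and ?K = "cross_term G w x y"
  define a b where "a = (if e then x i else inv (x i))" and "b = (if e then y i else inv (y i))"
  define c where "c = (if e then \<one> else commutator G (y i) (x i))"
  have [simp]: "a \<in> carrier G" "b \<in> carrier G" "c \<in> D" by (auto simp: a_def b_def c_def)
  \<comment> \<open>An inverse letter gives the two factors in reversed order; exchanging them costs
    the commutator of the inverses, which equals that of \<open>y i\<close> and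
    \<open>x i\<close>.\<close>
  have "(if e then x i \<otimes> y i else inv (x i \<otimes> y i)) = c \<otimes> (a \<otimes> b)"
    using commutator_swap[of "inv (y i)" "inv (x i)"]
    by (auto simp: a_def b_def c_def inv_mult_group commutator_inv_left commutator_inv_right)
  then have "word_eval G (l # w) (x \<odot> y) = c \<otimes> (a \<otimes> b) \<otimes> (?X \<otimes> ?Y \<otimes> ?K)"
    by (simp add: l Cons.IH)
  also have "\<dots> = c \<otimes> (a \<otimes> ((b \<otimes> ?X) \<otimes> (?Y \<otimes> ?K)))"
    by (simp add: m_assoc)
  also have "\<dots> = c \<otimes> (a \<otimes> ((commutator G b ?X \<otimes> (?X \<otimes> b)) \<otimes> (?Y \<otimes> ?K)))"
    by (simp add: commutator_swap[of b ?X])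
  also have "\<dots> = c \<otimes> (commutator G b ?X \<otimes> (a \<otimes> (?X \<otimes> (b \<otimes> (?Y \<otimes> ?K)))))"
    by (simp add: m_assoc D_lcomm[of _ a])
  also have "\<dots> = (a \<otimes> ?X \<otimes> (b \<otimes> ?Y)) \<otimes> (commutator G b ?X \<otimes> c \<otimes> ?K)"
    by (simp add: m_assoc D_lcomm[of _ a] D_lcomm[of _ ?X] D_lcomm[of _ b] D_lcomm[of _ ?Y]
        D_lcomm[of "commutator G b ?X" c])
  finally show ?case by (simp add: l a_def b_def c_def)
qed simp

lemma D_interchange3:
  assumes [simp]: "p \<in> D" "p' \<in> D" "q \<in> D" "q' \<in> D" "r \<in> D" "r' \<in> D"
  shows "(p \<otimes> p') \<otimes> (q \<otimes> q') \<otimes> (r \<otimes> r') = (p \<otimes> q \<otimes> r) \<otimes> (p' \<otimes> q' \<otimes> r')"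
  by (simp add: m_assoc D_lcomm[of _ p'] D_lcomm[of r q'])

lemma cross_term_mult_right:
  assumes [simp]: "\<And>i. x i \<in> carrier G" "\<And>i. y i \<in> carrier G" "\<And>i. z i \<in> carrier G"
  shows "cross_term G w x (y \<odot> z) = cross_term G w x y \<otimes> cross_term G w x z"
proof (induction w)
  case (Cons l w)
  obtain i e where l: "l = (i, e)" by fastforce
  let ?X = "word_eval G w x"
  have "commutator G (if e then y i \<otimes> z i else inv (y i \<otimes> z i)) ?X
      = commutator G (if e then y i else inv (y i)) ?X \<otimes> commutator G (if e then z i else inv (z i)) ?X"
    by (cases e) (simp_all add: commutator_mult_left inv_mult_group commutator_inv_left D_central)
  moreover have "(if e then \<one> else commutator G (y i \<otimes> z i) (x i))
      = (if e then \<one> else commutator G (y i) (x i)) \<otimes> (if e then \<one> else commutator G (z i) (x i))"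
    by (simp add: commutator_mult_left)
  ultimately show ?case by (simp only: l cross_term.simps Cons.IH) (rule D_interchange3, simp_all)
qed simp

text \<open>The word map itself is multiplicative only up to a factor in \<open>D\<close>, but that
  factor disappears inside a commutator.\<close>

lemma cross_term_mult_left:
  assumes [simp]: "\<And>i. x i \<in> carrier G" "\<And>i. y i \<in> carrier G" "\<And>i. z i \<in> carrier G"
  shows "cross_term G w (x \<odot> y) z = cross_term G w x z \<otimes> cross_term G w y z"
proof (induction w)
  case (Cons l w)
  obtain i e where l: "l = (i, e)" by fastforce
  have "commutator G (if e then z i else inv (z i)) (word_eval G w (x \<odot> y))
      = commutator G (if e then z i else inv (z i)) (word_eval G w x)
        \<otimes> commutator G (if e then z i else inv (z i)) (word_eval G w y)"
    by (simp add: word_eval_mult commutator_mult_right)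
  moreover have "(if e then \<one> else commutator G (z i) (x i \<otimes> y i))
      = (if e then \<one> else commutator G (z i) (x i)) \<otimes> (if e then \<one> else commutator G (z i) (y i))"
    by (simp add: commutator_mult_right)
  ultimately show ?case by (simp only: l cross_term.simps Cons.IH) (rule D_interchange3, simp_all)
qed simp

lemma word_eval_supp_singleton:
  "x \<in> supp_tuples G {m} \<Longrightarrow> word_eval G w x = x m [^] exp_sum w m"
  by (induction w m rule: exp_sum.induct)
    (auto simp: supp_tuples_def int_pow_mult int_pow_neg)

lemma word_eval_one: "word_eval G w (\<lambda>i. \<one>) = \<one>"
  by (induction w) auto

lemma cross_term_one_left: "(\<And>i. y i \<in> carrier G) \<Longrightarrow> cross_term G w (\<lambda>i. \<one>) y = \<one>"
  by (induction w) (auto simp: word_eval_one)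

lemma cross_term_D: "\<lbrakk>\<And>i. x i \<in> carrier G; \<And>i. y i \<in> D\<rbrakk> \<Longrightarrow> cross_term G w x y = \<one>"
  by (induction w) auto

text \<open>Each \<open>x_p\<close>-letter contributes the commutator of its value with the value of
  the rest of the word, a power of \<open>x q\<close>. Pair sums are thus the off-diagonal matrix
  entries of the bilinear map \<open>cross_term\<close>.\<close>

lemma cross_term_supp_singletons:
  assumes x: "x \<in> supp_tuples G {q}" and y: "y \<in> supp_tuples G {p}" and "p \<noteq> q"
  shows "cross_term G w x y = commutator G (y p) (x q) [^] pair_sum w p q"
proof (induction w)
  case (Cons l w)
  obtain i e where l: "l = (i, e)" by fastforce
  have [simp]: "x i \<in> carrier G" "y i \<in> carrier G" for i
    using x y by (auto simp: supp_tuples_def)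
  have [simp]: "commutator G (y i) (x i) = \<one>" for i
    using x y \<open>p \<noteq> q\<close> by (cases "i = p") (auto simp: supp_tuples_def)
  show ?case
  proof (cases "i = p")
    case True
    then show ?thesis
      by (auto simp: l Cons.IH word_eval_supp_singleton[OF x] commutator_int_pow_right
          commutator_inv_left int_pow_mult int_pow_neg int_pow_inv)
  next
    case False
    then have "y i = \<one>" using y by (auto simp: supp_tuples_def)
    with False show ?thesis by (simp add: l Cons.IH)
  qed
qed simp

lemma supp_tuples_split:
  assumes "x \<in> supp_tuples G (insert m S)"
  obtains y z where "y \<in> supp_tuples G S" "z \<in> supp_tuples G {m}" "x = y \<odot> z"
proof
  show "x(m := \<one>) \<in> supp_tuples G S" "(\<lambda>i. if i = m then x m else \<one>) \<in> supp_tuples G {m}"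
    "x = (x(m := \<one>)) \<odot> (\<lambda>i. if i = m then x m else \<one>)"
    using assms by (auto simp: supp_tuples_def fun_eq_iff)
qed

text \<open>By multiplicativity in \<open>x\<close>, the entries of \<open>x\<close> can be split
  off one at a time.\<close>

lemma cross_term_supp_eq_one:
  assumes "finite S" "y \<in> supp_tuples G {p}" "p \<notin> S" "\<And>q. q \<in> S \<Longrightarrow> pair_sum w p q = 0"
    and "x \<in> supp_tuples G S"
  shows "cross_term G w x y = \<one>"
  using assms
proof (induction S arbitrary: x rule: finite_induct)
  case empty
  then have "x = (\<lambda>i. \<one>)" by (auto simp: supp_tuples_def)
  with empty show ?case by (simp add: cross_term_one_left supp_tuples_def)
next
  case (insert m S)
  obtain u v where uv: "u \<in> supp_tuples G S" "v \<in> supp_tuples G {m}" "x = u \<odot> v"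
    using supp_tuples_split[OF insert.prems(4)] .
  have "cross_term G w v y = \<one>"
    using insert.prems uv by (subst cross_term_supp_singletons) auto
  moreover have "cross_term G w u y = \<one>" using insert uv by auto
  moreover have "cross_term G w x y = cross_term G w u y \<otimes> cross_term G w v y"
    unfolding uv(3) by (rule cross_term_mult_left) (use uv insert.prems in \<open>auto simp: supp_tuples_def\<close>)
  ultimately show ?case by simp
qed

text \<open>Splitting off one coordinate at a time, each contributes a zeroth power and a trivial
  cross term.\<close>

lemma word_eval_isotropic:
  assumes "finite S" "\<And>p. p \<in> S \<Longrightarrow> exp_sum w p = 0"
    and "\<And>p q. \<lbrakk>p \<in> S; q \<in> S; p \<noteq> q\<rbrakk> \<Longrightarrow> pair_sum w p q = 0"
    and "x \<in> supp_tuples G S"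
  shows "word_eval G w x = \<one>"
  using assms
proof (induction S arbitrary: x rule: finite_induct)
  case empty
  then have "x = (\<lambda>i. \<one>)" by (auto simp: supp_tuples_def)
  then show ?case by (simp add: word_eval_one)
next
  case (insert m S)
  obtain u v where uv: "u \<in> supp_tuples G S" "v \<in> supp_tuples G {m}" "x = u \<odot> v"
    using supp_tuples_split[OF insert.prems(3)] .
  have "word_eval G w u = \<one>" using insert uv by auto
  moreover have "word_eval G w v = \<one>"
    using word_eval_supp_singleton[OF uv(2)] insert.prems by simp
  moreover have "cross_term G w u v = \<one>"
    by (rule cross_term_supp_eq_one[OF insert.hyps(1) uv(2) insert.hyps(2)]) (use insert uv in auto)
  moreover have "word_eval G w x = word_eval G w u \<otimes> word_eval G w v \<otimes> cross_term G w u v"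
    unfolding uv(3) by (rule word_eval_mult) (use uv in \<open>auto simp: supp_tuples_def\<close>)
  ultimately show ?case by simp
qed

section \<open>Counting kernels of homomorphisms into the derived subgroup\<close>

lemma inj_on_pmult_inv:
  assumes "x \<in> supp_tuples G S"
  shows "inj_on (\<lambda>y. y \<odot> (\<lambda>i. inv (x i))) (supp_tuples G S)"
proof (rule inj_onI)
  fix y z
  assume "y \<in> supp_tuples G S" "z \<in> supp_tuples G S" "y \<odot> (\<lambda>i. inv (x i)) = z \<odot> (\<lambda>i. inv (x i))"
  with assms show "y = z" by (auto simp: supp_tuples_def fun_eq_iff)
qed

lemma pmult_inv_in_supp_tuples:
  "\<lbrakk>x \<in> supp_tuples G S; y \<in> supp_tuples G S\<rbrakk> \<Longrightarrow> y \<odot> (\<lambda>i. inv (x i)) \<in> supp_tuples G S"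
  by (auto simp: supp_tuples_def)

lemma cross_term_pmult_inv:
  assumes [simp]: "\<And>i. a i \<in> carrier G" "\<And>i. x i \<in> carrier G" "\<And>i. y i \<in> carrier G"
  shows "cross_term G w a (y \<odot> (\<lambda>i. inv (x i))) \<otimes> cross_term G w a x = cross_term G w a y"
  by (subst cross_term_mult_right[symmetric]) (simp_all add: m_assoc)

lemma card_le_card_D_mult_kernel:
  assumes fin: "finite (carrier G)" and a: "\<And>i. a i \<in> carrier G" and S: "finite S"
  shows "card (supp_tuples G S) \<le> card D * card {u \<in> supp_tuples G S. cross_term G w a u = \<one>}"
proof (rule card_le_card_mult_kernel[where h = "\<lambda>x y. y \<odot> (\<lambda>i. inv (x i))"])
  show "finite D" using fin by (rule finite_D)
  show "finite (supp_tuples G S)" using S fin by (rule finite_supp_tuples)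
  show "cross_term G w a ` supp_tuples G S \<subseteq> D" using a by (auto simp: supp_tuples_def)
next
  fix x y
  assume x: "x \<in> supp_tuples G S" and y: "y \<in> supp_tuples G S"
    and eq: "cross_term G w a y = cross_term G w a x"
  have [simp]: "x i \<in> carrier G" "y i \<in> carrier G" for i using x y by (auto simp: supp_tuples_def)
  have "cross_term G w a (y \<odot> (\<lambda>i. inv (x i))) \<otimes> cross_term G w a x = cross_term G w a x"
    using eq by (simp add: cross_term_pmult_inv a)
  then have "cross_term G w a (y \<odot> (\<lambda>i. inv (x i))) = \<one>" by (simp add: a)
  with pmult_inv_in_supp_tuples[OF x y]
  show "y \<odot> (\<lambda>i. inv (x i)) \<in> supp_tuples G S \<and> cross_term G w a (y \<odot> (\<lambda>i. inv (x i))) = \<one>" by blast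
qed (rule inj_on_pmult_inv)

text \<open>The map sending \<open>(v, z)\<close> to \<open>cross_term G w a v\<close> times the
  \<open>n\<close>-th power of \<open>z\<close> is a homomorphism into \<open>D\<close>. Its kernel
  has index at most \<open>card D\<close>, and the factor \<open>D\<close> of the domain cancels
  exactly this loss.\<close>

lemma card_le_card_kernel_with_power:
  fixes n :: int
  assumes fin: "finite (carrier G)" and a: "\<And>i. a i \<in> carrier G" and S: "finite S"
  shows "card (supp_tuples G S)
    \<le> card {(v, z) \<in> supp_tuples G S \<times> D. cross_term G w a v \<otimes> z [^] n = \<one>}"
proof -
  let ?f = "\<lambda>(v, z). cross_term G w a v \<otimes> z [^] n"
  let ?h = "\<lambda>(x, z) (x', z'). (x' \<odot> (\<lambda>i. inv (x i)), z' \<otimes> inv z)"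
  have finD: "finite D" using fin by (rule finite_D)
  have "card (supp_tuples G S \<times> D) \<le> card D * card {p \<in> supp_tuples G S \<times> D. ?f p = \<one>}"
  proof (rule card_le_card_mult_kernel[where h = ?h])
    show "finite (supp_tuples G S \<times> D)" using finite_supp_tuples[OF S fin] finD by simp
    show "?f ` (supp_tuples G S \<times> D) \<subseteq> D" using a by (auto simp: supp_tuples_def)
  next
    fix p assume "p \<in> supp_tuples G S \<times> D"
    then obtain x z where p: "p = (x, z)" "x \<in> supp_tuples G S" "z \<in> D" by blast
    show "inj_on (?h p) (supp_tuples G S \<times> D)"
      using inj_on_pmult_inv[OF p(2)] p(3) by (auto simp: p(1) inj_on_def)
  next
    fix p q
    assume "p \<in> supp_tuples G S \<times> D" "q \<in> supp_tuples G S \<times> D" and eq: "?f q = ?f p"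
    then obtain x z y z' where pq: "p = (x, z)" "q = (y, z')" and x: "x \<in> supp_tuples G S"
      and y: "y \<in> supp_tuples G S" and [simp]: "z \<in> D" "z' \<in> D" by blast
    have [simp]: "x i \<in> carrier G" "y i \<in> carrier G" for i using x y by (auto simp: supp_tuples_def)
    let ?k = "cross_term G w a (y \<odot> (\<lambda>i. inv (x i)))" and ?c = "cross_term G w a x"
    have [simp]: "?k \<in> D" "?c \<in> D" by (simp_all add: a)
    \<comment> \<open>Power maps are multiplicative on \<open>D\<close>, whose elements are
      central.\<close>
    have z': "z' [^] n = (z' \<otimes> inv z) [^] n \<otimes> z [^] n"
    proof -
      have "(z' \<otimes> inv z) \<otimes> z = z'" by (simp add: m_assoc)
      moreover have "(z' \<otimes> inv z) \<otimes> z = z \<otimes> (z' \<otimes> inv z)" by (rule D_central) simp_all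
      ultimately show ?thesis
        using int_pow_mult_distrib[of "z' \<otimes> inv z" z n] by simp
    qed
    have "(?k \<otimes> (z' \<otimes> inv z) [^] n) \<otimes> (?c \<otimes> z [^] n)
        = (?k \<otimes> ?c) \<otimes> ((z' \<otimes> inv z) [^] n \<otimes> z [^] n)"
      by (simp add: m_assoc D_lcomm[of ?c])
    also have "\<dots> = ?c \<otimes> z [^] n"
      using eq by (simp add: pq cross_term_pmult_inv a z'[symmetric])
    finally have "?k \<otimes> (z' \<otimes> inv z) [^] n = \<one>" by simp
    then show "?h p q \<in> supp_tuples G S \<times> D \<and> ?f (?h p q) = \<one>"
      using pmult_inv_in_supp_tuples[OF x y] by (simp add: pq)
  qed (rule finD)
  moreover have "card D > 0" using finD D_one card_gt_0_iff by blast
  moreover have "{p \<in> supp_tuples G S \<times> D. ?f p = \<one>}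
      = {(v, z) \<in> supp_tuples G S \<times> D. cross_term G w a v \<otimes> z [^] n = \<one>}" by auto
  ultimately show ?thesis by (simp add: card_cartesian_product mult.commute)
qed

section \<open>Fibres of words in normal form\<close>

text \<open>Distinct indices of equal parity are never adjacent, so the entry above the diagonal is
  zero; the one below is its negative because \<open>exp_sum w p\<close> vanishes.\<close>

lemma tridiagonal_pair_sum:
  assumes "tridiagonal_below k k w" "0 < p" "p < k" "0 < q" "q < k" "p \<noteq> q" "even p = even q"
  shows "pair_sum w p q = 0"
proof -
  have *: "pair_sum w p q = 0" if "p < q" "0 < p" "q < k" "even p = even q" for p q
  proof -
    have "Suc p \<noteq> q" using that(4) by auto
    with that assms(1) show ?thesis by (auto simp: tridiagonal_below_def)
  qed
  have "exp_sum w p = 0" using assms by (auto simp: tridiagonal_below_def)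
  then have "pair_sum w p q = - pair_sum w q p" using pair_sum_swap[OF assms(6), of w] by simp
  then show ?thesis using *[of p q] *[of q p] assms by (cases "p < q") auto
qed

text \<open>On positive indices of one parity the word is trivial, so only the correction survives,
  and it is a homomorphism in \<open>y\<close>.\<close>

lemma word_eval_mult_parity:
  assumes "tridiagonal_below k k w" and x: "\<And>i. x i \<in> carrier G"
    and y: "y \<in> supp_tuples G {i. 0 < i \<and> i < k \<and> even i = b}"
  shows "word_eval G w (x \<odot> y) = word_eval G w x \<otimes> cross_term G w x y"
proof -
  have [simp]: "y i \<in> carrier G" for i using y by (auto simp: supp_tuples_def)
  have "word_eval G w y = \<one>"
    by (rule word_eval_isotropic[OF _ _ _ y])
      (use assms(1) tridiagonal_pair_sum in \<open>auto simp: tridiagonal_below_def\<close>)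
  then show ?thesis by (simp add: word_eval_mult x)
qed

text \<open>The fibre receives an injection from the triples \<open>(u, v, z)\<close> with
  \<open>u\<close> in \<open>U0\<close> and \<open>(v, z)\<close> in \<open>W u\<close>. There are
  at least \<open>card U0 * card ?V\<close> of them, and \<open>U0\<close> has index at most
  \<open>card D\<close> in \<open>?U\<close>.\<close>

lemma card_fibre_tridiagonal:
  assumes fin: "finite (carrier G)" and "k \<ge> 1" and tri: "tridiagonal_below k k w"
    and a: "a \<in> fibre k w g"
  shows "card (carrier G) ^ (k - 1) \<le> card D * card (fibre k w g)"
proof -
  \<comment> \<open>Index 0 belongs to neither class: \<open>x_0\<close> is varied only by the
    factor \<open>z\<close> from \<open>D\<close>, which leaves \<open>k - 1\<close> free
    positions.\<close>
  define S where "S b = {i. 0 < i \<and> i < k \<and> even i = b}" for b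
  have finS: "finite (S b)" for b by (simp add: S_def)
  let ?U = "supp_tuples G (S True)" and ?V = "supp_tuples G (S False)"
  define U0 where "U0 = {u \<in> ?U. cross_term G w a u = \<one>}"
  \<comment> \<open>The base point is now the translate of \<open>a\<close> by \<open>u\<close>, so
    this kernel varies with \<open>u\<close>; the lower bound for its size does not.\<close>
  define W where "W u = {(v, z) \<in> ?V \<times> D. cross_term G w (a \<odot> u) v \<otimes> z [^] exp_sum w 0 = \<one>}" for u
  define \<zeta> where "\<zeta> z = (\<lambda>i::nat. if i = 0 then z else \<one>)" for z
  have aC [simp]: "a i \<in> carrier G" for i using a by (auto simp: fibre_def supp_tuples_def)
  have finD: "finite D" using fin by (rule finite_D)
  have finU0: "finite U0" unfolding U0_def using finite_supp_tuples[OF finS fin] by simp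
  have finW: "finite (W u)" for u
    unfolding W_def using finite_supp_tuples[OF finS fin] finD
    by (auto intro: finite_subset[of _ "?V \<times> D"])
  have finF: "finite (fibre k w g)" unfolding fibre_def using finite_supp_tuples[OF _ fin] by simp
  have "S True \<union> S False = {1..<k}" "S True \<inter> S False = {}" by (auto simp: S_def)
  then have "card (S True) + card (S False) = k - 1"
    using card_Un_disjoint[OF finS finS, of True False] by simp
  then have UV: "card ?U * card ?V = card (carrier G) ^ (k - 1)"
    by (simp add: card_supp_tuples finS power_add[symmetric])
  let ?\<Phi> = "\<lambda>(u, v, z). a \<odot> u \<odot> v \<odot> \<zeta> z"
  \<comment> \<open>The supports of \<open>u\<close>, \<open>v\<close> and \<open>\<zeta> z\<close>
    are disjoint, so each factor can be read off at its own indices.\<close>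
  have "inj_on ?\<Phi> (Sigma U0 W)"
  proof (rule inj_onI)
    fix p p' assume "p \<in> Sigma U0 W" "p' \<in> Sigma U0 W" and eq: "?\<Phi> p = ?\<Phi> p'"
    then obtain u v z u' v' z' where p: "p = (u, v, z)" "p' = (u', v', z')"
      and uv: "u \<in> ?U" "u' \<in> ?U" "v \<in> ?V" "v' \<in> ?V" and [simp]: "z \<in> D" "z' \<in> D"
      by (auto simp: U0_def W_def)
    have e: "a i \<otimes> u i \<otimes> v i \<otimes> \<zeta> z i = a i \<otimes> u' i \<otimes> v' i \<otimes> \<zeta> z' i" for i
      using eq by (auto simp: p fun_eq_iff)
    have [simp]: "u i \<in> carrier G" "u' i \<in> carrier G" "v i \<in> carrier G" "v' i \<in> carrier G" for i
      using uv by (auto simp: supp_tuples_def)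
    have u1: "u i = \<one>" "u' i = \<one>" if "i \<notin> S True" for i using uv that by (auto simp: supp_tuples_def)
    have v1: "v i = \<one>" "v' i = \<one>" if "i \<notin> S False" for i using uv that by (auto simp: supp_tuples_def)
    have "u i = u' i" for i
    proof (cases "i \<in> S True")
      case True
      then have "i \<notin> S False" "i \<noteq> 0" by (auto simp: S_def)
      then show ?thesis using e[of i] by (simp add: v1 \<zeta>_def)
    qed (simp add: u1)
    moreover have "v i = v' i" for i
    proof (cases "i \<in> S False")
      case True
      then have "i \<notin> S True" "i \<noteq> 0" by (auto simp: S_def)
      then show ?thesis using e[of i] by (simp add: u1 \<zeta>_def)
    qed (simp add: v1)
    moreover have "z = z'"
    proof -
      have "0 \<notin> S True" "0 \<notin> S False" by (auto simp: S_def)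
      then show ?thesis using e[of 0] by (simp add: u1 v1 \<zeta>_def)
    qed
    ultimately show "p = p'" by (auto simp: p)
  qed
  moreover have "?\<Phi> ` Sigma U0 W \<subseteq> fibre k w g"
  proof clarify
    fix u v z assume u: "u \<in> U0" and vz: "(v, z) \<in> W u"
    then have uv: "u \<in> ?U" "v \<in> ?V" and [simp]: "z \<in> D" by (auto simp: U0_def W_def)
    have [simp]: "u i \<in> carrier G" "v i \<in> carrier G" "\<zeta> z i \<in> D" for i
      using uv by (auto simp: supp_tuples_def \<zeta>_def)
    have g: "word_eval G w a = g" using a by (simp add: fibre_def)
    then have [simp]: "g \<in> carrier G" using aC word_eval_closed by blast
    have "word_eval G w (a \<odot> u) = g"
      using word_eval_mult_parity[OF tri aC, of u True] uv(1) u by (simp add: S_def U0_def g)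
    then have av: "word_eval G w (a \<odot> u \<odot> v) = g \<otimes> cross_term G w (a \<odot> u) v"
      using word_eval_mult_parity[OF tri, of "a \<odot> u" v False] uv(2) by (simp add: S_def)
    have "\<zeta> z \<in> supp_tuples G {0}" by (simp add: supp_tuples_def \<zeta>_def)
    then have "word_eval G w (\<zeta> z) = z [^] exp_sum w 0"
      by (simp add: word_eval_supp_singleton) (simp add: \<zeta>_def)
    \<comment> \<open>Since \<open>\<zeta> z\<close> takes values in \<open>D\<close>, its cross
      term is trivial and it contributes only its own word value.\<close>
    then have "word_eval G w (a \<odot> u \<odot> v \<odot> \<zeta> z)
        = g \<otimes> cross_term G w (a \<odot> u) v \<otimes> z [^] exp_sum w 0"
      by (simp add: word_eval_mult[of "a \<odot> u \<odot> v"] cross_term_D av)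
    also have "\<dots> = g" using vz by (simp add: W_def m_assoc)
    finally have "word_eval G w (a \<odot> u \<odot> v \<odot> \<zeta> z) = g" .
    moreover have "a \<odot> u \<odot> v \<odot> \<zeta> z \<in> supp_tuples G {..<k}"
      using a uv \<open>k \<ge> 1\<close> by (auto simp: fibre_def supp_tuples_def S_def \<zeta>_def)
    ultimately show "a \<odot> u \<odot> v \<odot> \<zeta> z \<in> fibre k w g" by (simp add: fibre_def)
  qed
  ultimately have "card (Sigma U0 W) \<le> card (fibre k w g)"
    using finF by (rule card_inj_on_le)
  moreover have "card ?V \<le> card (W u)" if "u \<in> U0" for u
    unfolding W_def
    by (rule card_le_card_kernel_with_power[OF fin _ finS])
      (use that in \<open>auto simp: U0_def supp_tuples_def\<close>)
  then have "card U0 * card ?V \<le> card (Sigma U0 W)"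
    using sum_bounded_below[of U0 "card ?V" "\<lambda>u. card (W u)"] finU0 finW by simp
  ultimately have "card U0 * card ?V \<le> card (fibre k w g)" by linarith
  then have "card D * card U0 * card ?V \<le> card D * card (fibre k w g)" by simp
  moreover have "card ?U * card ?V \<le> card D * card U0 * card ?V"
    unfolding U0_def by (rule mult_le_mono1[OF card_le_card_D_mult_kernel[OF fin aC finS]])
  ultimately show ?thesis using UV by linarith
qed

end

section \<open>From the lower central series to the probability bound\<close>

lemma commutator_in_comm_subgroup:
  "\<lbrakk>a \<in> A; b \<in> B\<rbrakk> \<Longrightarrow> commutator G a b \<in> comm_subgroup G A B"
  unfolding comm_subgroup_def commutator_def by (rule generate.incl) blast

text \<open>Indexing starts at 0, so \<open>lower_central G 2\<close> is the third term of the
  series and contains every commutator of a commutator with a group element.\<close>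

lemma class2_groupI:
  assumes "group G" "lower_central G 2 = {\<one>\<^bsub>G\<^esub>}"
  shows "class2_group G"
proof -
  interpret group G by fact
  show ?thesis
  proof
    fix a b c assume abc: "a \<in> carrier G" "b \<in> carrier G" "c \<in> carrier G"
    define d where "d = commutator G a b"
    have d: "d \<in> carrier G" using abc by (simp add: d_def commutator_def)
    have "commutator G d c \<in> lower_central G 2"
      using abc by (simp add: numeral_2_eq_2 d_def commutator_in_comm_subgroup)
    then have "commutator G d c = \<one>\<^bsub>G\<^esub>" using assms(2) by simp
    then have "d \<otimes>\<^bsub>G\<^esub> c \<otimes>\<^bsub>G\<^esub> inv\<^bsub>G\<^esub> (c \<otimes>\<^bsub>G\<^esub> d) = \<one>\<^bsub>G\<^esub>"
      using abc d by (simp add: commutator_def inv_mult_group m_assoc)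
    then have "d \<otimes>\<^bsub>G\<^esub> c = c \<otimes>\<^bsub>G\<^esub> d"
      using inv_solve_right[of "\<one>\<^bsub>G\<^esub>" "d \<otimes>\<^bsub>G\<^esub> c" "c \<otimes>\<^bsub>G\<^esub> d"] abc d by simp
    then show "commutator G a b \<otimes>\<^bsub>G\<^esub> c = c \<otimes>\<^bsub>G\<^esub> commutator G a b" by (simp add: d_def)
  qed
qed

theorem theorem3p1:
  fixes G :: "('a, 'b) monoid_scheme" and k :: nat and w :: fword and g :: 'a
  assumes "group G" and "finite (carrier G)" and "nilpotency_class G 2"
    and "k \<ge> 1" and "is_word k w" and "g \<in> word_image G k w"
  shows "word_prob G k w g \<ge> 1 / (real (card (derived G (carrier G))) * real (card (carrier G)))"
proof -
  interpret class2_group G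
    using assms(1,3) by (intro class2_groupI) (auto simp: nilpotency_class_def)
  obtain w' where w': "\<And>g. card (fibre k w' g) = card (fibre k w g)" "tridiagonal_below k k w'"
    using ex_tridiagonal_below[OF assms(5,4)] by blast
  have "finite {x \<in> tuples G k. word_eval G w x = g}"
    using assms(2) by (simp add: tuples_def finite_PiE)
  \<comment> \<open>Fibres of \<open>w\<close> and \<open>w'\<close> are compared only by size, so
    the solution for \<open>w\<close> passes to \<open>w'\<close> as a nonzero cardinality.\<close>
  then have "card {x \<in> tuples G k. word_eval G w x = g} \<noteq> 0"
    using assms(6) by (auto simp: word_image_def)
  then have "card (fibre k w' g) \<noteq> 0"
    by (simp add: card_fibre[OF assms(5)] w'(1))
  then obtain a where "a \<in> fibre k w' g" by (metis card.empty ex_in_conv)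
  from card_fibre_tridiagonal[OF assms(2,4) w'(2) this]
  have "card (carrier G) ^ (k - 1) \<le> card D * card {x \<in> tuples G k. word_eval G w x = g}"
    by (simp add: card_fibre[OF assms(5)] w'(1))
  then have "real (card (carrier G) ^ (k - 1))
      \<le> real (card D * card {x \<in> tuples G k. word_eval G w x = g})"
    by (rule of_nat_mono)
  then have le: "real (card (carrier G)) ^ (k - 1)
      \<le> real (card D) * real (card {x \<in> tuples G k. word_eval G w x = g})"
    by simp
  have "D \<noteq> {}" "carrier G \<noteq> {}" using D_one one_closed by blast+
  then have pos: "real (card D) > 0" "real (card (carrier G)) > 0"
    using finite_D[OF assms(2)] assms(2) by (simp_all add: card_gt_0_iff)
  \<comment> \<open>As \<open>k\<close> is positive, one factor \<open>card (carrier G)\<close>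
    splits off; it is the one in the denominator of the bound.\<close>
  have "real (card (carrier G)) ^ k = real (card (carrier G)) * real (card (carrier G)) ^ (k - 1)"
    using assms(4) by (cases k) simp_all
  then show ?thesis
    unfolding word_prob_def using le pos by (simp add: field_simps)
qed

end
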